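(* Let $\aleph$ be a positive integer with $\frac{\aleph-1}{2}\in\mathbb N$ and $\iota\aleph\in\mathbb N$, sufficiently large, and set $\mathtt M=\exp\big(\iota(\log\log(\iota^{-1}))^4\aleph\big)$. For every $\mathbf T\in\widetilde{\mathcal T}_\aleph$ there exist pairings $W_1,\dots,W_{\mathtt M}$ of $\mathbf T$ such that: (1) $\mathsf{Vert}(W_i)\subset V(\mathbf T_\iota)\setminus\{\mathfrak R(\mathbf T)\}$ for all $i$, where $\mathfrak R(\mathbf T)$ is the root; (2) for all $i$ and every descendant tree $\mathbf T'$ of $\mathbf T$ with $|V(\mathbf T')|\ge\log^2(\iota^{-1})$, $|\mathsf{Vert}(W_i)\cap V(\mathbf T')|\le\log^{-1}(\iota^{-1})\cdot|V(\mathbf T')|$; (3) $|\mathsf{Vert}(W_i)\,\triangle\,\mathsf{Vert}(W_j)|\ge\frac{\iota\aleph}{2}$ for all $i\ne j$; (4) for all $i$: $(\log\log(\iota^{-1}))^{10}\le\mathsf{Dist}_{\mathbf T}(\mathbf u,\mathbf v)\le2(\log\log(\iota^{-1}))^{10}$ for every pair $(\mathbf u,\mathbf v)\in W_i$, and $\mathsf{Dist}_{\mathbf T}(\mathbf u,\mathbf v)\ge10(\log\log(\iota^{-1}))^{10}$ for all $\mathbf u,\mathbf v\in\mathsf{Vert}(W_i)$ with $(\mathbf u,\mathbf v)\notin W_i$; and for all $i<j$ and $\mathbf u\in\mathsf{Vert}(W_i)$, $\mathbf v\in\mathsf{Vert}(W_j)$ with $\mathbf u\ne\mathbf v$, $\mathsf{Dist}_{\mathbf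 T}(\mathbf u,\mathbf v)\ge(\log\log(\iota^{-1}))^{10}$.
   Context: All logarithms are natural and $\log^k(x)=(\log x)^k$. $\alpha\approx0.338$ is Otter's constant; $\mathcal V_N$ (resp. $\mathcal R_N$) is the set of unlabeled trees (resp. rooted trees) on $N$ vertices. Fix $\epsilon\in(0,1)$, an integer $M\ge100$ such that for all $k\ge M$: $\alpha^{-k}/(100k^{2.5})\le|\mathcal V_k|\le\alpha^{-k}/k^{2.5}$ and $\alpha^{-k}/(200k^{1.5})\le|\mathcal R_k|\le\alpha^{-k}/k^{1.5}$; and $\iota\in(0,1)$ with $\log\log\log\log(\iota^{-1})>\max\{M,\frac1\epsilon,\frac1{\log(\epsilon^{-1})}\}$. A pairing of a tree $\mathbf T$ on $\aleph$ vertices is a set $\xi=\{(u_1,v_1),\dots,(u_{\iota\aleph},v_{\iota\aleph})\}$ where the $2\iota\aleph$ vertices $u_1,\dots,u_{\iota\aleph},v_1,\dots,v_{\iota\aleph}$ are distinct; $\mathsf{Vert}(\xi)$ is the set of these vertices. $\mathsf{Dist}_{\mathbf T}$ is graph distance. Tree notions. For a rooted tree $\mathbf T$, $\mathsf{Des}_{\mathbf T}(v)$ is the rooted tree with root $v$ consisting of $v$ and its descendants; descendant trees of $\mathbf T$ are the trees $\mathsf{Des}_{\mathbf T}(v)$. Leaves are degree-1 vertices. A self-avoiding path $(u_1,\dots,u_m)$ is an arm-path starting from $u_1$, of length $m-1$, if it equals $\mathsf{Des}_{\mathbf T}(u_1)$. $\mathbf T\oplus\mathcal L^{(x)}_{\mathbf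 u}$ is $\mathbf T$ with a new path of $x$ edges attached at $\mathbf u$. $\mathbf T\sim\mathbf T'$ iff there exist $k\le|V(\mathbf T)|/\log(\iota^{-1})$, $k'\le|V(\mathbf T')|/\log(\iota^{-1})$, non-leaf vertices $\mathbf u_1,\dots,\mathbf u_k$ of $\mathbf T$, $\mathbf u'_1,\dots,\mathbf u'_{k'}$ of $\mathbf T'$ and integers $0\le x_i,x'_j\le\log^2(\iota^{-1})$ with $\mathbf T\oplus\mathcal L^{(x_1)}_{\mathbf u_1}\oplus\cdots\oplus\mathcal L^{(x_k)}_{\mathbf u_k}\cong\mathbf T'\oplus\mathcal L^{(x'_1)}_{\mathbf u'_1}\oplus\cdots\oplus\mathcal L^{(x'_{k'})}_{\mathbf u'_{k'}}$. $\mathbf T_\iota$ is the subtree induced on $\{v:|V(\mathsf{Des}_{\mathbf T}(v))|\ge\log^2(\iota^{-1})\}$. $\widetilde{\mathcal T}_\aleph$ is the set of rooted trees $\mathbf T\in\mathcal R_\aleph$ such that: (1) all degrees are at most $\log^2(\iota^{-1})$; (2) no arm-path of length at least $\log^2(\iota^{-1})$; (3) $|V(\mathbf T_\iota)|\ge\aleph/\log^4(\iota^{-1})$; (4) any two distinct descendant trees with at least $\log^2(\iota^{-1})$ vertices whose roots have a common parent are not $\sim$-related; (5) the root has exactly two children with descendant trees $\mathbf T_1,\mathbf T_2$ of sizes $\lfloor\frac{\aleph-1}2\rfloor,\lceil\frac{\aleph-1}2\rceil$, with $\mathbf T_1\not\sim\mathbf S$ for all descendant trees $\mathbf S$ of $\mathbf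 T_2$ and $\mathbf T_2\not\sim\mathbf S'$ for all descendant trees $\mathbf S'$ of $\mathbf T_1$. *)

theory Defs
  imports "HOL-Analysis.Summation_Tests" "Graph_Theory.Graph_Theory"
begin

section \<open>Trees and rooted trees\<close>

text \<open>
  An undirected simple graph is a symmetric loop-free pair digraph, in which each edge gives
  two opposite arcs. A closed walk using an edge back and forth is then a \<^emph>\<open>cycle\<close> of length 2 in
  the sense of \<^const>\<open>pre_digraph.cycle\<close>, so the predicate \<^const>\<open>tree\<close> of Graph\_Theory
  does not describe undirected trees; only cycles of length at least 3 are excluded here.
\<close>

definition is_tree :: "'a pair_pre_digraph \<Rightarrow> bool" where
  "is_tree G \<longleftrightarrow> pair_graph G \<and> Digraph_Component.connected (with_proj G) \<and>
     \<not> (\<exists>p. pre_digraph.cycle (with_proj G) p \<and> 3 \<le> length p)"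

definition induced :: "'a pair_pre_digraph \<Rightarrow> 'a set \<Rightarrow> 'a pair_pre_digraph" where
  "induced G S = \<lparr> pverts = S, parcs = parcs G \<inter> S \<times> S \<rparr>"

record 'a rtree =
  rgraph :: "'a pair_pre_digraph"
  rroot :: 'a

definition is_rtree :: "'a rtree \<Rightarrow> bool" where
  "is_rtree T \<longleftrightarrow> is_tree (rgraph T) \<and> rroot T \<in> pverts (rgraph T)"

abbreviation V :: "'a rtree \<Rightarrow> 'a set" where
  "V T \<equiv> pverts (rgraph T)"

abbreviation deg :: "'a rtree \<Rightarrow> 'a \<Rightarrow> nat" where
  "deg T v \<equiv> out_degree (with_proj (rgraph T)) v"

definition Dist :: "'a rtree \<Rightarrow> 'a \<Rightarrow> 'a \<Rightarrow> ereal" where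
  "Dist T u v = wf_digraph.\<mu> (with_proj (rgraph T)) (\<lambda>_. 1) u v"

definition rtree_iso :: "'a rtree \<Rightarrow> 'b rtree \<Rightarrow> bool" where
  "rtree_iso T T' \<longleftrightarrow>
     (\<exists>f. pre_digraph.digraph_isomorphism (with_proj (rgraph T)) f \<and>
          with_proj (rgraph T') = app_iso f (with_proj (rgraph T)) \<and>
          iso_verts f (rroot T) = rroot T')"

section \<open>Unlabeled trees and Otter's constant\<close>

text \<open>Unlabeled trees are isomorphism classes of trees; every finite tree has a copy on a set
  of natural numbers.\<close>

definition unlabeled_trees :: "nat \<Rightarrow> nat pair_pre_digraph set set" where
  "unlabeled_trees N =
     {G. is_tree G \<and> card (pverts G) = N} // {(G, H). digraph_iso (with_proj G) (with_proj H)}"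

definition rtrees :: "nat \<Rightarrow> nat rtree set" where
  "rtrees N = {T. is_rtree T \<and> card (V T) = N}"

definition unlabeled_rtrees :: "nat \<Rightarrow> nat rtree set set" where
  "unlabeled_rtrees N = rtrees N // {(T, T'). rtree_iso T T'}"

text \<open>Otter's constant, about 0.338, is the radius of convergence of the generating function
  of unlabeled rooted trees.\<close>

definition otter :: real where
  "otter = real_of_ereal (conv_radius (\<lambda>n. real (card (unlabeled_rtrees n))))"

section \<open>Descendant trees\<close>

definition child :: "'a rtree \<Rightarrow> 'a \<Rightarrow> 'a \<Rightarrow> bool" where
  "child T p c \<longleftrightarrow> (p, c) \<in> parcs (rgraph T) \<and> Dist T (rroot T) c = Dist T (rroot T) p + 1"

definition Des :: "'a rtree \<Rightarrow> 'a \<Rightarrow> 'a rtree" where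
  "Des T v = \<lparr> rgraph = induced (rgraph T) {w. (child T)\<^sup>*\<^sup>* v w}, rroot = v \<rparr>"

definition descendant_trees :: "'a rtree \<Rightarrow> 'a rtree set" where
  "descendant_trees T = Des T ` V T"

definition leaf :: "'a rtree \<Rightarrow> 'a \<Rightarrow> bool" where
  "leaf T v \<longleftrightarrow> v \<in> V T \<and> deg T v = 1"

definition arm_path :: "'a rtree \<Rightarrow> 'a list \<Rightarrow> bool" where
  "arm_path T us \<longleftrightarrow> vpath us (with_proj (rgraph T)) \<and>
     rgraph (Des T (hd us)) =
       \<lparr> pverts = set us, parcs = set (vwalk_arcs us) \<union> (set (vwalk_arcs us))\<inverse> \<rparr>"

definition T_iota :: "real \<Rightarrow> 'a rtree \<Rightarrow> 'a pair_pre_digraph" where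
  "T_iota \<iota> T =
     induced (rgraph T) {v \<in> V T. real (card (V (Des T v))) \<ge> (ln (1 / \<iota>))\<^sup>2}"

section \<open>Attaching paths\<close>

text \<open>The \<open>x\<close> new vertices are the numbers following the largest vertex of \<open>T\<close>.\<close>

definition attach_path :: "nat rtree \<Rightarrow> nat \<Rightarrow> nat \<Rightarrow> nat rtree" where
  "attach_path T u x =
     (let m = Suc (Max (V T)); p = u # [m..<m + x] in
      \<lparr> rgraph = \<lparr> pverts = V T \<union> set p,
                  parcs = parcs (rgraph T) \<union> set (vwalk_arcs p) \<union> (set (vwalk_arcs p))\<inverse> \<rparr>,
        rroot = rroot T \<rparr>)"

definition attach_paths :: "nat rtree \<Rightarrow> (nat \<times> nat) list \<Rightarrow> nat rtree" where
  "attach_paths T uxs = foldl (\<lambda>S (u, x). attach_path S u x) T uxs"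

definition admissible :: "real \<Rightarrow> nat rtree \<Rightarrow> (nat \<times> nat) list \<Rightarrow> bool" where
  "admissible \<iota> T uxs \<longleftrightarrow> real (length uxs) \<le> real (card (V T)) / ln (1 / \<iota>) \<and>
     (\<forall>(u, x) \<in> set uxs. u \<in> V T \<and> \<not> leaf T u \<and> real x \<le> (ln (1 / \<iota>))\<^sup>2)"

definition sim :: "real \<Rightarrow> nat rtree \<Rightarrow> nat rtree \<Rightarrow> bool" where
  "sim \<iota> T T' \<longleftrightarrow> (\<exists>uxs uxs'. admissible \<iota> T uxs \<and> admissible \<iota> T' uxs' \<and>
     rtree_iso (attach_paths T uxs) (attach_paths T' uxs'))"

section \<open>The class of trees\<close>

text \<open>Representatives of the unlabeled rooted trees in the class: all properties required are
  invariant under rooted isomorphism.\<close>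

definition tilde_T :: "real \<Rightarrow> nat \<Rightarrow> nat rtree set" where
  "tilde_T \<iota> N = {T \<in> rtrees N.
     (\<forall>v \<in> V T. real (deg T v) \<le> (ln (1 / \<iota>))\<^sup>2) \<and>
     \<not> (\<exists>us. arm_path T us \<and> real (vwalk_length us) \<ge> (ln (1 / \<iota>))\<^sup>2) \<and>
     real (card (pverts (T_iota \<iota> T))) \<ge> real N / (ln (1 / \<iota>)) ^ 4 \<and>
     (\<forall>p v w. child T p v \<and> child T p w \<and> v \<noteq> w \<and>
        real (card (V (Des T v))) \<ge> (ln (1 / \<iota>))\<^sup>2 \<and>
        real (card (V (Des T w))) \<ge> (ln (1 / \<iota>))\<^sup>2 \<longrightarrow> \<not> sim \<iota> (Des T v) (Des T w)) \<and>
     (\<exists>a b. a \<noteq> b \<and> {c. child T (rroot T) c} = {a, b} \<and>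
        int (card (V (Des T a))) = \<lfloor>(real N - 1) / 2\<rfloor> \<and>
        int (card (V (Des T b))) = \<lceil>(real N - 1) / 2\<rceil> \<and>
        (\<forall>S \<in> descendant_trees (Des T b). \<not> sim \<iota> (Des T a) S) \<and>
        (\<forall>S' \<in> descendant_trees (Des T a). \<not> sim \<iota> (Des T b) S'))}"

section \<open>Pairings\<close>

text \<open>
  A caveat on the standing assumption \<open>ln (ln (ln (ln (1 / \<iota>)))) > c\<close>: the library has
  \<open>ln (- x) = ln x\<close> on the reals, so the inequality alone could also hold through negative inner
  logarithms, for \<open>\<iota>\<close> close to 1. Where it is assumed, the arguments of all four logarithms have
  to be assumed positive as well.
\<close>

definition pairing :: "real \<Rightarrow> 'a rtree \<Rightarrow> ('a \<times> 'a) set \<Rightarrow> bool" where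
  "pairing \<iota> T \<xi> \<longleftrightarrow> (\<exists>us vs. \<xi> = set (zip us vs) \<and>
     real (length us) = \<iota> * real (card (V T)) \<and> length vs = length us \<and>
     distinct (us @ vs) \<and> set (us @ vs) \<subseteq> V T)"

definition Vert :: "('a \<times> 'a) set \<Rightarrow> 'a set" where
  "Vert \<xi> = fst ` \<xi> \<union> snd ` \<xi>"

end

theory Submission
  imports Defs
begin

text \<open>
  All pairings are assembled from one fixed family of slots \<open>(u, f u)\<close>, where \<open>f u\<close> is the ancestor
  of \<open>u\<close> at distance \<open>D = \<lceil>L ^ 10\<rceil>\<close>. Write \<open>K = ln (1 / \<iota>)\<close> and \<open>L = ln K\<close>. Among the vertices of
  \<open>T_iota\<close> of depth more than \<open>D\<close>, of which there are about \<open>N / K ^ 4\<close>, a maximal family of vertices at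
  mutual distance at least \<open>10 * L ^ 10 + 2 * D\<close> loses only a factor \<open>(K\<^sup>2 + 1) ^ O(L ^ 10)\<close>, since
  degrees are at most \<open>K\<^sup>2\<close>. The vertex sets of descendant trees are laminar, so thinning the family
  to density \<open>1 / (2 * K)\<close> in each large descendant tree costs a further factor \<open>4 * K + 1\<close>; as \<open>f u\<close>
  is an ancestor of \<open>u\<close>, the density of the endpoints is at most twice that of the slots. The
  remaining number of slots exceeds \<open>\<iota> * N\<close> by a factor \<open>exp (K - O(L ^ 11))\<close>, where \<open>K = exp L\<close>,
  so the slots split into \<open>m = \<iota> * N\<close> groups of more than \<open>exp (2 * L ^ 4)\<close> slots, and a
  Gilbert--Varshamov code over these groups picks the required number of pairings.
\<close>

section \<open>Separated and sparse subfamilies\<close>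

text \<open>By maximality every element of \<open>X\<close> is related to some member of
  \<open>Y\<close>, so the sets \<open>{x \<in> X. R y x}\<close> for \<open>y \<in> Y\<close>, each
  of size at most \<open>C\<close>, cover \<open>X\<close>. The relation will be nearness in a tree
  and nearness in Hamming distance.\<close>

lemma separated_subset:
  fixes X :: "'a set"
  assumes fin: "finite X"
    and refl: "\<And>x. x \<in> X \<Longrightarrow> R x x"
    and sym: "\<And>x y. x \<in> X \<Longrightarrow> y \<in> X \<Longrightarrow> R x y \<Longrightarrow> R y x"
    and card: "\<And>x. x \<in> X \<Longrightarrow> card {y \<in> X. R x y} \<le> C"
  shows "\<exists>Y\<subseteq>X. (\<forall>x\<in>Y. \<forall>y\<in>Y. x \<noteq> y \<longrightarrow> \<not> R x y) \<and> card X \<le> C * card Y"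
proof -
  define S where "S = {Y. Y \<subseteq> X \<and> (\<forall>x\<in>Y. \<forall>y\<in>Y. x \<noteq> y \<longrightarrow> \<not> R x y)}"
  have "finite S" using fin by (simp add: S_def)
  moreover have "{} \<in> S" by (simp add: S_def)
  ultimately obtain Y where "Y \<in> S" and maximal: "\<And>Z. Z \<in> S \<Longrightarrow> Y \<subseteq> Z \<Longrightarrow> Y = Z"
    using finite_has_maximal[of S] by blast
  then have Y: "Y \<subseteq> X" "\<And>x y. x \<in> Y \<Longrightarrow> y \<in> Y \<Longrightarrow> x \<noteq> y \<Longrightarrow> \<not> R x y"
    by (auto simp: S_def)
  have "X \<subseteq> (\<Union>y\<in>Y. {x \<in> X. R y x})"
  proof
    fix x assume x: "x \<in> X"
    show "x \<in> (\<Union>y\<in>Y. {x \<in> X. R y x})"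
    proof (rule ccontr)
      assume far: "x \<notin> (\<Union>y\<in>Y. {x \<in> X. R y x})"
      then have "insert x Y \<in> S" using Y x sym unfolding S_def by blast
      then have "x \<in> Y" using maximal[of "insert x Y"] by auto
      then show False using far x refl by blast
    qed
  qed
  moreover have "finite Y" using Y(1) fin by (rule finite_subset)
  ultimately have "card X \<le> (\<Sum>y\<in>Y. card {x \<in> X. R y x})"
    using fin by (intro order.trans[OF card_mono card_UN_le] finite_UN_I) auto
  also have "\<dots> \<le> (\<Sum>y\<in>Y. C)"
    using Y card by (intro sum_mono) auto
  finally have "card X \<le> C * card Y" by (simp add: mult.commute)
  then show ?thesis using Y by (intro exI[of _ Y]) auto
qed

text \<open>If \<open>Y\<close> is maximal, every element of \<open>X - Y\<close> lies in a member of \<open>\<F>\<close> whose bound is tight; the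
  maximal tight members are disjoint, and each contains an element of \<open>Y\<close> since \<open>card F \<ge> B\<close>.\<close>

lemma laminar_selection:
  fixes X :: "'a set" and \<F> :: "'a set set" and B :: real
  assumes fin: "finite X" "finite \<F>" "\<And>F. F \<in> \<F> \<Longrightarrow> finite F"
    and laminar: "\<And>F G. F \<in> \<F> \<Longrightarrow> G \<in> \<F> \<Longrightarrow> F \<inter> G = {} \<or> F \<subseteq> G \<or> G \<subseteq> F"
    and B: "B > 0" and large: "\<And>F. F \<in> \<F> \<Longrightarrow> B \<le> card F"
  shows "\<exists>Y\<subseteq>X. (\<forall>F\<in>\<F>. B * card (Y \<inter> F) \<le> card F) \<and> card X \<le> (2 * B + 1) * card Y"
proof -
  define S where "S = {Y. Y \<subseteq> X \<and> (\<forall>F\<in>\<F>. B * card (Y \<inter> F) \<le> card F)}"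
  have "finite S" using fin by (simp add: S_def)
  moreover have "{} \<in> S" by (simp add: S_def)
  ultimately obtain Y where "Y \<in> S" and maximal: "\<And>Z. Z \<in> S \<Longrightarrow> Y \<subseteq> Z \<Longrightarrow> Y = Z"
    using finite_has_maximal[of S] by blast
  then have Y: "Y \<subseteq> X" "\<And>F. F \<in> \<F> \<Longrightarrow> B * card (Y \<inter> F) \<le> card F"
    by (auto simp: S_def)
  have finY: "finite Y" using Y(1) fin(1) by (rule finite_subset)
  \<comment> \<open>A set is tight when one more of its elements in \<open>Y\<close> would break its
    bound; tight sets are what prevents enlarging \<open>Y\<close>.\<close>
  define \<G> where "\<G> = {F \<in> \<F>. card F < B * (card (Y \<inter> F) + 1)}"
  define \<M> where "\<M> = {F \<in> \<G>. \<forall>G\<in>\<G>. F \<subseteq> G \<longrightarrow> F = G}"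
  have M: "\<M> \<subseteq> \<G>" "\<G> \<subseteq> \<F>" by (auto simp: \<M>_def \<G>_def)
  have finM: "finite \<M>" using M by (intro finite_subset[OF _ fin(2)]) blast
  have cover: "X - Y \<subseteq> \<Union>\<M>"
  proof
    fix x assume x: "x \<in> X - Y"
    then have "insert x Y \<notin> S" using maximal[of "insert x Y"] by auto
    then obtain F where F: "F \<in> \<F>" "\<not> B * card (insert x Y \<inter> F) \<le> card F"
      using x Y by (auto simp: S_def)
    have "x \<in> F"
    proof (rule ccontr)
      assume "x \<notin> F"
      then show False using F Y by auto
    qed
    then have "card (insert x Y \<inter> F) = card (Y \<inter> F) + 1"
      using x finY by simp
    then have "F \<in> \<G>" using F by (simp add: \<G>_def)
    moreover have "finite \<G>" using M(2) fin(2) by (rule finite_subset)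
    ultimately obtain G where "G \<in> \<G>" "F \<subseteq> G" "\<forall>H\<in>\<G>. G \<subseteq> H \<longrightarrow> G = H"
      using finite_has_maximal2[of \<G> F] by auto
    then show "x \<in> \<Union>\<M>" using \<open>x \<in> F\<close> by (auto simp: \<M>_def)
  qed
  have disj: "F \<inter> G = {}" if "F \<in> \<M>" "G \<in> \<M>" "F \<noteq> G" for F G
  proof -
    have "F \<in> \<F>" "G \<in> \<F>" using that M by auto
    with laminar[OF this] that show ?thesis by (auto simp: \<M>_def)
  qed
  have "real (card F) \<le> 2 * B * card (Y \<inter> F)" if "F \<in> \<M>" for F
  proof -
    have F: "card F < B * (card (Y \<inter> F) + 1)" "B \<le> card F"
      using that M large by (auto simp: \<G>_def)
    have "card (Y \<inter> F) \<noteq> 0"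
    proof
      assume zero: "card (Y \<inter> F) = 0"
      from F(1) have "real (card F) < B" unfolding zero by simp
      with F(2) show False by simp
    qed
    \<comment> \<open>For \<open>n \<ge> 1\<close>, \<open>n + 1 \<le> 2 * n\<close>: this is the
      source of the 2 in the factor \<open>2 * B + 1\<close>.\<close>
    then have "B * (card (Y \<inter> F) + 1) \<le> B * (2 * card (Y \<inter> F))"
      using B by (intro mult_left_mono) auto
    then show ?thesis using F(1) by simp
  qed
  then have sum_le: "(\<Sum>F\<in>\<M>. real (card F)) \<le> (\<Sum>F\<in>\<M>. 2 * B * card (Y \<inter> F))"
    by (rule sum_mono)
  have "card (X - Y) \<le> card (\<Union>\<M>)"
    using finM M fin(3) by (intro card_mono[OF _ cover] finite_Union) auto
  also have "\<dots> \<le> (\<Sum>F\<in>\<M>. card F)"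
    using card_Union_le_sum_card_weak[of \<M>] M fin(3) by auto
  finally have "real (card (X - Y)) \<le> (\<Sum>F\<in>\<M>. real (card F))"
    by (simp only: of_nat_le_iff flip: of_nat_sum)
  also note sum_le
  also have "(\<Sum>F\<in>\<M>. 2 * B * card (Y \<inter> F)) = 2 * B * real (\<Sum>F\<in>\<M>. card (Y \<inter> F))"
    by (simp add: sum_distrib_left)
  also have "(\<Sum>F\<in>\<M>. card (Y \<inter> F)) = card (\<Union>F\<in>\<M>. Y \<inter> F)"
    using finM finY disj by (intro card_UN_disjoint[symmetric]) auto
  also have "card (\<Union>F\<in>\<M>. Y \<inter> F) \<le> card Y"
    using finY by (intro card_mono) auto
  finally have "real (card (X - Y)) \<le> 2 * B * card Y"
    using B by (simp add: mult_left_mono)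
  moreover have "card X = card (X - Y) + card Y"
    using Y fin(1) finY by (simp add: card_Diff_subset card_mono)
  ultimately have "card X \<le> (2 * B + 1) * card Y" by (simp add: algebra_simps)
  then show ?thesis using Y by (intro exI[of _ Y]) auto
qed

text \<open>The alphabet size is a square in order that a Hamming ball of radius below \<open>m / 2\<close> has at most
  \<open>2 ^ m * s ^ m\<close> elements, without roots.\<close>

lemma half_distance_code:
  fixes m s :: nat
  assumes "s > 0"
  shows "\<exists>\<C> \<subseteq> PiE {..<m} (\<lambda>_. {..<s\<^sup>2}).
    (\<forall>f\<in>\<C>. \<forall>g\<in>\<C>. f \<noteq> g \<longrightarrow> m \<le> 2 * card {k\<in>{..<m}. f k \<noteq> g k}) \<and> s ^ m \<le> 2 ^ m * card \<C>"
proof -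
  define X where "X = PiE {..<m} (\<lambda>_. {..<s\<^sup>2})"
  \<comment> \<open>The disjunct \<open>f = g\<close> keeps \<open>R\<close> reflexive when
    \<open>m = 0\<close>, where the strict inequality fails.\<close>
  define R where "R f g \<longleftrightarrow> 2 * card {k\<in>{..<m}. f k \<noteq> g k} < m \<or> f = g" for f g :: "nat \<Rightarrow> nat"
  have finX: "finite X" by (simp add: X_def finite_PiE)
  have card_near: "card {g \<in> X. R f g} \<le> 2 ^ m * s ^ m" if f: "f \<in> X" for f
  proof -
    \<comment> \<open>A word near \<open>f\<close> is classified by the set \<open>A\<close> of
      positions where it differs from \<open>f\<close>; there are at most \<open>2 ^ m\<close> such
      sets, and \<open>?Z A\<close> holds all words that agree with \<open>f\<close> off
      \<open>A\<close>.\<close>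
    let ?U = "{A. A \<subseteq> {..<m} \<and> 2 * card A \<le> m}"
    let ?Z = "\<lambda>A. PiE {..<m} (\<lambda>k. if k \<in> A then {..<s\<^sup>2} else {f k})"
    have finU: "finite ?U" by simp
    have "{g \<in> X. R f g} \<subseteq> (\<Union>A\<in>?U. ?Z A)"
    proof
      fix g assume g: "g \<in> {g \<in> X. R f g}"
      let ?A = "{k\<in>{..<m}. f k \<noteq> g k}"
      have "2 * card ?A \<le> m" using g by (auto simp: R_def)
      then have "?A \<in> ?U" by auto
      moreover have "g \<in> ?Z ?A" using g by (auto simp: X_def PiE_def Pi_def extensional_def)
      ultimately show "g \<in> (\<Union>A\<in>?U. ?Z A)" by blast
    qed
    then have "card {g \<in> X. R f g} \<le> card (\<Union>A\<in>?U. ?Z A)"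
      using finU by (intro card_mono finite_UN_I finite_PiE) auto
    also have "\<dots> \<le> (\<Sum>A\<in>?U. card (?Z A))" by (rule card_UN_le[OF finU])
    also have "\<dots> \<le> (\<Sum>A\<in>?U. s ^ m)"
    proof (rule sum_mono)
      fix A assume A: "A \<in> ?U"
      have "card (?Z A) = (\<Prod>k<m. if k \<in> A then s\<^sup>2 else 1)"
        by (simp add: card_PiE if_distrib cong: if_cong)
      also have "\<dots> = (\<Prod>k\<in>A. s\<^sup>2)"
        using A by (subst prod.inter_restrict[symmetric]) (auto simp: Int_absorb1)
      also have "\<dots> = s ^ (2 * card A)" by (simp add: power_mult)
      also have "\<dots> \<le> s ^ m" using A assms by (intro power_increasing) auto
      finally show "card (?Z A) \<le> s ^ m" .
    qed
    also have "\<dots> = card ?U * s ^ m" by simp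
    also have "card ?U \<le> card (Pow {..<m})" by (intro card_mono) auto
    also have "card (Pow {..<m}) = 2 ^ m" by (simp add: card_Pow)
    finally show ?thesis by simp
  qed
  have "R f f" for f by (simp add: R_def)
  moreover have "R f g \<Longrightarrow> R g f" for f g
    by (simp add: R_def eq_commute)
  ultimately obtain \<C> where C: "\<C> \<subseteq> X" "\<forall>f\<in>\<C>. \<forall>g\<in>\<C>. f \<noteq> g \<longrightarrow> \<not> R f g"
    "card X \<le> 2 ^ m * s ^ m * card \<C>"
    using separated_subset[OF finX, of R "2 ^ m * s ^ m"] card_near by blast
  \<comment> \<open>One of the two factors \<open>s ^ m\<close> is spent on the size of a ball; the
    other remains for the code.\<close>
  have "card X = s ^ m * s ^ m"
    by (simp add: X_def card_PiE power2_eq_square power_mult_distrib)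
  then have "s ^ m * s ^ m \<le> s ^ m * (2 ^ m * card \<C>)"
    using C(3) by (simp add: mult_ac)
  then have "s ^ m \<le> 2 ^ m * card \<C>" using assms by simp
  moreover have "\<forall>f\<in>\<C>. \<forall>g\<in>\<C>. f \<noteq> g \<longrightarrow> m \<le> 2 * card {k\<in>{..<m}. f k \<noteq> g k}"
    using C(2) by (auto simp: R_def not_less)
  ultimately show ?thesis using C(1) unfolding X_def by blast
qed

section \<open>Estimates\<close>

text \<open>A single term of the exponential series is at most its sum. With \<open>n = 12\<close>
  this makes \<open>exp L\<close> exceed polynomials of degree 11 in \<open>L\<close>.\<close>

lemma exp_ge_power_div_fact:
  fixes x :: real
  assumes "x \<ge> 0"
  shows "x ^ n / fact n \<le> exp x"
proof -
  have "(\<Sum>k\<in>{n}. x ^ k /\<^sub>R fact k) \<le> (\<Sum>k. x ^ k /\<^sub>R fact k)"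
    using assms by (intro sum_le_suminf summable_exp_generic) auto
  then show ?thesis by (simp add: exp_def divide_inverse mult.commute)
qed

text \<open>Exponentiating twice gives \<open>L > exp (exp 100)\<close>, of which only a crude
  consequence is kept. The positivity assumptions license \<open>exp (ln x) = x\<close>.\<close>

lemma iterated_log_large:
  assumes "ln (ln L) > 100" "ln L > 0" "L > (0::real)"
  shows "L \<ge> 2 ^ 100"
proof -
  have "exp 100 < ln L"
    using assms(1,2) by (metis exp_less_cancel_iff exp_ln)
  moreover have "101 \<le> exp (100::real)" using exp_ge_add_one_self[of 100] by simp
  ultimately have "exp 100 \<le> L" using assms(2,3)
    by (metis exp_le_cancel_iff exp_ln less_eq_real_def add.commute exp_ge_add_one_self order.trans add_increasing2 zero_le_one)
  moreover have "(2::real) ^ 100 \<le> exp 1 ^ 100"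
    using exp_ge_add_one_self[of 1] by (intro power_mono) auto
  ultimately show ?thesis by (simp add: exp_of_nat_mult[symmetric])
qed

text \<open>Each factor on the left is at most the exponential of a polynomial in \<open>L\<close>
  of degree at most 11, since \<open>r\<close> has order \<open>L ^ 10\<close> and \<open>K\<close>
  is \<open>exp L\<close>, whereas the exponent \<open>K\<close> on the right is at least
  \<open>L ^ 12 / fact 12\<close>.\<close>

lemma code_size_bound:
  fixes L K :: real and r :: nat
  assumes L: "L \<ge> 2 ^ 100" and K: "K = exp L" and r: "real r \<le> 12 * L ^ 10 + 3"
  shows "18 * exp (2 * L ^ 4) * K ^ 4 * (4 * K + 1) * (K\<^sup>2 + 1) ^ r \<le> exp K"
proof -
  have L1: "L \<ge> 1" using L by simp
  have K2: "K \<ge> 2" using exp_ge_add_one_self[of L] L1 K by linarith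
  have "K\<^sup>2 + 1 \<le> K ^ 3"
  proof -
    have "K\<^sup>2 * 2 \<le> K\<^sup>2 * K" using K2 by (intro mult_left_mono) auto
    moreover have "1 \<le> K\<^sup>2" using K2 by (simp add: one_le_power)
    ultimately show ?thesis by (simp add: power3_eq_cube power2_eq_square)
  qed
  then have "(K\<^sup>2 + 1) ^ r \<le> (K ^ 3) ^ r" using K2 by (intro power_mono) auto
  also have "\<dots> = exp (3 * L * real r)"
    by (simp add: K exp_of_nat_mult[symmetric] power_mult[symmetric] mult_ac)
  finally have a: "(K\<^sup>2 + 1) ^ r \<le> exp (3 * L * real r)" .
  have b: "4 * K + 1 \<le> exp (3 + L)"
  proof -
    have "(5::real) \<le> 2 ^ 3" by simp
    also have "\<dots> \<le> exp 1 ^ 3" using exp_ge_add_one_self[of 1] by (intro power_mono) auto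
    also have "\<dots> = exp 3" by (simp add: exp_of_nat_mult[symmetric])
    finally have "5 * K \<le> exp 3 * K" using K2 by (intro mult_right_mono) auto
    moreover have "4 * K + 1 \<le> 5 * K" using K2 by simp
    ultimately show ?thesis unfolding exp_add K by linarith
  qed
  have c: "(18::real) \<le> exp 5"
  proof -
    have "(18::real) \<le> 2 ^ 5" by simp
    also have "\<dots> \<le> exp 1 ^ 5" using exp_ge_add_one_self[of 1] by (intro power_mono) auto
    finally show ?thesis by (simp add: exp_of_nat_mult[symmetric])
  qed
  have d: "K ^ 4 = exp (4 * L)" by (simp add: K exp_of_nat_mult[symmetric])
  have "18 * exp (2 * L ^ 4) * K ^ 4 * (4 * K + 1) * (K\<^sup>2 + 1) ^ r
    \<le> exp 5 * exp (2 * L ^ 4) * exp (4 * L) * exp (3 + L) * exp (3 * L * real r)"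
    using K2 unfolding d by (intro mult_mono a b c order_refl mult_nonneg_nonneg) auto
  also have "\<dots> = exp (8 + 2 * L ^ 4 + 5 * L + 3 * L * real r)"
    by (simp add: exp_add[symmetric] algebra_simps)
  also have "\<dots> \<le> exp (L ^ 12 / fact 12)"
  proof -
    have pw: "L ^ i \<le> L ^ 11" if "i \<le> 11" for i using that L1 by (rule power_increasing)
    have "3 * L * real r \<le> 3 * L * (12 * L ^ 10 + 3)"
      using r L1 by (intro mult_left_mono) auto
    also have "\<dots> = 36 * L ^ 11 + 9 * L ^ 1" by (simp add: algebra_simps eval_nat_numeral)
    \<comment> \<open>The coefficients add up to \<open>8 + 2 + 5 + 36 + 9 = 60\<close>, every power
      of \<open>L\<close> being at most \<open>L ^ 11\<close>.\<close>
    finally have "8 + 2 * L ^ 4 + 5 * L + 3 * L * real r \<le> 60 * L ^ 11"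
      using pw[of 0] pw[of 4] pw[of 1] by simp
    \<comment> \<open>The size of \<open>L\<close> enters here, through
      \<open>60 * fact 12 \<le> 2 ^ 100\<close>.\<close>
    also have "\<dots> \<le> L / fact 12 * L ^ 11"
      using L L1 by (intro mult_right_mono) (auto simp: fact_numeral field_simps)
    also have "\<dots> = L ^ 12 / fact 12" by (simp add: eval_nat_numeral)
    finally show ?thesis by simp
  qed
  also have "\<dots> \<le> exp K"
    using exp_ge_power_div_fact[of L 12] L1 K by simp
  finally show ?thesis .
qed

section \<open>Distances and descendants in rooted trees\<close>

lemma pawalk_verts_snoc:
  "pcas u p b \<Longrightarrow> pawalk_verts u (p @ [(b, c)]) = pawalk_verts u p @ [c]"
  by (induction u p b rule: pcas.induct) auto

text \<open>A natural-number form of \<open>Dist\<close>, with which it agrees on \<open>V T\<close>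
  by \<open>Dist_eq\<close>; relation powers allow induction on the distance. If no walk exists, the
  value is unspecified.\<close>

definition rdist :: "'a rtree \<Rightarrow> 'a \<Rightarrow> 'a \<Rightarrow> nat" where
  "rdist T u v = (LEAST n. (u, v) \<in> parcs (rgraph T) ^^ n)"

locale rooted_tree =
  fixes T :: "'a rtree"
  assumes is_rtree: "is_rtree T"
begin

abbreviation "E \<equiv> parcs (rgraph T)"
abbreviation "depth \<equiv> rdist T (rroot T)"

sublocale pair_graph "rgraph T"
  using is_rtree by (simp add: is_rtree_def is_tree_def)

lemma finite_V [simp]: "finite (V T)"
  using pair_finite_verts by simp

lemma root_in_V [simp]: "rroot T \<in> V T"
  using is_rtree by (simp add: is_rtree_def)

lemma E_sym: "(u, v) \<in> E \<Longrightarrow> (v, u) \<in> E"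
  using arcs_symmetric by blast

lemma no_long_cycle: "cycle p \<Longrightarrow> length p < 3"
  using is_rtree by (auto simp: is_rtree_def is_tree_def)

lemma awalk_imp_relpow: "awalk u p v \<Longrightarrow> (u, v) \<in> E ^^ length p"
proof (induction p arbitrary: u)
  case (Cons e p)
  then show ?case
    by (cases e) (auto simp: awalk_Cons_iff simp del: relpow.simps intro: relpow_Suc_I2)
qed (simp add: awalk_Nil_iff)

lemma relpow_imp_awalk:
  assumes "(u, v) \<in> E ^^ n" "u \<in> V T"
  shows "\<exists>p. awalk u p v \<and> length p = n"
  using assms
proof (induction n arbitrary: u)
  case 0
  then show ?case by (auto simp: awalk_Nil_iff)
next
  case (Suc n)
  from Suc.prems(1) obtain w where w: "(u, w) \<in> E" "(w, v) \<in> E ^^ n"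
    by (meson relpow_Suc_D2)
  obtain p where "awalk w p v" "length p = n"
    using Suc.IH[OF w(2)] w(1) in_arcsD2 by blast
  then show ?case
    using w(1) by (intro exI[of _ "(u, w) # p"]) (simp add: awalk_Cons_iff)
qed

lemma awalk_exists:
  assumes "u \<in> V T" "v \<in> V T"
  shows "\<exists>p. awalk u p v"
proof -
  have "Digraph_Component.connected (with_proj (rgraph T))"
    using is_rtree by (simp add: is_rtree_def is_tree_def)
  then have "u \<rightarrow>\<^sup>*\<^bsub>with_proj (mk_symmetric (with_proj (rgraph T)))\<^esub> v"
    using assms by (auto simp: connected_def strongly_connected_def)
  then show ?thesis
    using reachable_mk_symmetric_eq sym_arcs reachable_awalk by blast
qed

lemma rdist_relpow:
  assumes "u \<in> V T" "v \<in> V T"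
  shows "(u, v) \<in> E ^^ rdist T u v"
  unfolding rdist_def using awalk_exists[OF assms] awalk_imp_relpow by (metis LeastI_ex)

lemma rdist_le: "(u, v) \<in> E ^^ n \<Longrightarrow> rdist T u v \<le> n"
  unfolding rdist_def by (rule Least_le)

text \<open>\<open>Dist\<close> is an infimum of walk costs; with unit costs these are lengths, and
  a shortest walk attains the infimum.\<close>

lemma Dist_eq:
  assumes "u \<in> V T" "v \<in> V T"
  shows "Dist T u v = ereal (real (rdist T u v))"
proof -
  have cost: "awalk_cost (\<lambda>_. 1) p = real (length p)" for p :: "('a \<times> 'a) list"
    by (induction p) (auto simp: awalk_cost_def)
  obtain p where p: "awalk u p v" "length p = rdist T u v"
    using relpow_imp_awalk[OF rdist_relpow[OF assms] assms(1)] by blast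
  show ?thesis
    unfolding Dist_def \<mu>_def
  proof (rule INF_eqI)
    fix q assume "q \<in> {p. awalk u p v}"
    then have "rdist T u v \<le> length q"
      using awalk_imp_relpow rdist_le by blast
    then show "ereal (real (rdist T u v)) \<le> ereal (awalk_cost (\<lambda>_. 1) q)"
      by (simp add: cost)
  next
    fix y assume "\<And>q. q \<in> {p. awalk u p v} \<Longrightarrow> y \<le> ereal (awalk_cost (\<lambda>_. 1) q)"
    from this[of p] p show "y \<le> ereal (real (rdist T u v))"
      by (simp add: cost)
  qed
qed

lemma rdist_self [simp]: "rdist T u u = 0"
  using rdist_le[of u u 0] by simp

lemma rdist_eq_0D: "u \<in> V T \<Longrightarrow> v \<in> V T \<Longrightarrow> rdist T u v = 0 \<Longrightarrow> u = v"
  using rdist_relpow[of u v] by simp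

lemma rdist_triangle:
  assumes "u \<in> V T" "v \<in> V T" "w \<in> V T"
  shows "rdist T u w \<le> rdist T u v + rdist T v w"
  using rdist_relpow[OF assms(1,2)] rdist_relpow[OF assms(2,3)]
  by (intro rdist_le) (auto simp: relpow_add)

lemma rdist_commute: "rdist T u v = rdist T v u"
proof -
  have "(v, u) \<in> E ^^ n" if "(u, v) \<in> E ^^ n" for u v n
    using that
  proof (induction n arbitrary: v)
    case (Suc n)
    then obtain w where "(u, w) \<in> E ^^ n" "(w, v) \<in> E" by auto
    then show ?case using Suc.IH E_sym relpow_Suc_I2 by metis
  qed simp
  then have "(u, v) \<in> E ^^ n \<longleftrightarrow> (v, u) \<in> E ^^ n" for n
    by blast
  then show ?thesis by (simp add: rdist_def)
qed

lemma card_neighbours: "deg T u = card {v. (u, v) \<in> E}"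
proof -
  have "out_arcs (with_proj (rgraph T)) u = Pair u ` {v. (u, v) \<in> E}"
    by (auto simp: out_arcs_def)
  then show ?thesis
    by (simp add: out_degree_def card_image inj_on_def)
qed

text \<open>A vertex at distance \<open>r + 1\<close> is adjacent to one at distance
  \<open>r\<close>, so each unit of radius costs a factor of at most
  \<open>\<Delta> + 1\<close>.\<close>

lemma card_ball:
  assumes deg: "\<forall>v\<in>V T. deg T v \<le> \<Delta>" and u: "u \<in> V T"
  shows "card {v \<in> V T. rdist T u v \<le> r} \<le> (\<Delta> + 1) ^ r"
proof (induction r)
  case 0
  have "{v \<in> V T. rdist T u v \<le> 0} = {u}"
    using u rdist_eq_0D by auto
  then show ?case by simp
next
  case (Suc r)
  let ?B = "{v \<in> V T. rdist T u v \<le> r}"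
  have "{v \<in> V T. rdist T u v \<le> Suc r} \<subseteq> (\<Union>x\<in>?B. insert x {v. (x, v) \<in> E})"
  proof
    fix v assume v: "v \<in> {v \<in> V T. rdist T u v \<le> Suc r}"
    show "v \<in> (\<Union>x\<in>?B. insert x {v. (x, v) \<in> E})"
    proof (cases "rdist T u v \<le> r")
      case False
      then have "rdist T u v = Suc r" using v by simp
      then have "(u, v) \<in> E ^^ Suc r" using rdist_relpow[OF u, of v] v by simp
      then obtain x where "(u, x) \<in> E ^^ r" "(x, v) \<in> E" by auto
      then show ?thesis using rdist_le in_arcsD1 by blast
    qed (use v in auto)
  qed
  moreover have "finite (\<Union>x\<in>?B. insert x {v. (x, v) \<in> E})"
    by (rule finite_subset[OF _ finite_V]) (auto dest: in_arcsD2)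
  ultimately have "card {v \<in> V T. rdist T u v \<le> Suc r} \<le> card (\<Union>x\<in>?B. insert x {v. (x, v) \<in> E})"
    by (rule card_mono[rotated])
  also have "\<dots> \<le> (\<Sum>x\<in>?B. card (insert x {v. (x, v) \<in> E}))"
    by (rule card_UN_le) simp
  also have "\<dots> \<le> (\<Sum>x\<in>?B. \<Delta> + 1)"
  proof (rule sum_mono)
    fix x assume "x \<in> ?B"
    then have "card {v. (x, v) \<in> E} \<le> \<Delta>" using deg card_neighbours by auto
      moreover have "finite {v. (x, v) \<in> E}"
      by (rule finite_subset[OF _ finite_V]) (auto dest: in_arcsD2)
    ultimately show "card (insert x {v. (x, v) \<in> E}) \<le> \<Delta> + 1"
      by (simp add: card_insert_if)
  qed
  also have "\<dots> = card ?B * (\<Delta> + 1)" by simp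
  also have "\<dots> \<le> (\<Delta> + 1) ^ r * (\<Delta> + 1)" by (rule mult_right_mono[OF Suc]) simp
  finally show ?case by (simp add: mult.commute)
qed

section \<open>Depth, children and uniqueness of parents\<close>

lemma child_iff: "child T p c \<longleftrightarrow> (p, c) \<in> E \<and> depth c = depth p + 1"
proof (cases "(p, c) \<in> E")
  case True
  then have "p \<in> V T" "c \<in> V T" using in_arcsD1 in_arcsD2 by auto
  then show ?thesis using True by (auto simp: child_def Dist_eq one_ereal_def)
qed (simp add: child_def)

lemma child_in_V: "child T p c \<Longrightarrow> p \<in> V T \<and> c \<in> V T"
  using child_iff in_arcsD1 in_arcsD2 by blast

lemma parent_exists:
  assumes "v \<in> V T" "depth v = Suc n"
  shows "\<exists>p. child T p v \<and> depth p = n"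
proof -
  have "(rroot T, v) \<in> E ^^ Suc n" using rdist_relpow[OF root_in_V assms(1)] assms(2) by simp
  then obtain p where p: "(rroot T, p) \<in> E ^^ n" "(p, v) \<in> E" by auto
  have "p \<in> V T" using p in_arcsD1 by blast
  have "depth p \<le> n" using p rdist_le by blast
  moreover have "Suc n \<le> depth p + 1"
    using rdist_triangle[OF root_in_V \<open>p \<in> V T\<close> assms(1)] rdist_le[of p v 1] p assms by simp
  ultimately show ?thesis using p(2) assms child_iff by auto
qed

text \<open>Joined to a common child of \<open>a\<close> and \<open>b\<close>, such a path becomes a cycle, so parents are unique.\<close>

lemma path_below_depth:
  assumes "a \<in> V T" "b \<in> V T" "a \<noteq> b" "depth a = n" "depth b = n"
  shows "\<exists>p. awalk a p b \<and> distinct (pawalk_verts a p) \<and> (\<forall>x\<in>set (pawalk_verts a p). depth x \<le> n)"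
  using assms
proof (induction n arbitrary: a b)
  case 0
  then show ?case using rdist_eq_0D[OF root_in_V] by metis
next
  case (Suc n)
  obtain a' where a': "child T a' a" "depth a' = n" using parent_exists Suc.prems by blast
  obtain b' where b': "child T b' b" "depth b' = n" using parent_exists Suc.prems by blast
  have V: "a' \<in> V T" "b' \<in> V T" using a' b' child_in_V by auto
  have "\<exists>p. awalk a' p b' \<and> distinct (pawalk_verts a' p) \<and> (\<forall>x\<in>set (pawalk_verts a' p). depth x \<le> n)"
  proof (cases "a' = b'")
    case True
    then show ?thesis using V a' by (intro exI[of _ "[]"]) (auto simp: awalk_Nil_iff)
  next
    case False
    then show ?thesis using Suc.IH V a' b' by blast
  qed
  then obtain p where p: "awalk a' p b'" "distinct (pawalk_verts a' p)"
    "\<And>x. x \<in> set (pawalk_verts a' p) \<Longrightarrow> depth x \<le> n" by blast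
  have cas: "pcas a' p b'" using p(1) by (auto simp: awalk_def)
  have "(a, a') \<in> E" "(b', b) \<in> E" using a' b' E_sym by (auto simp: child_iff)
  then have "awalk a ((a, a') # p @ [(b', b)]) b"
    using p(1) by (auto simp: awalk_Cons_iff awalk_Nil_iff dest: in_arcsD2)
  \<comment> \<open>The new ends have depth \<open>Suc n\<close>, while the path between the parents
    stays at depth at most \<open>n\<close>; so no vertex repeats.\<close>
  moreover have "a \<notin> set (pawalk_verts a' p)" "b \<notin> set (pawalk_verts a' p)"
    using p(3) Suc.prems by fastforce+
  ultimately show ?case
    using pawalk_verts_snoc[OF cas] p Suc.prems
    by (intro exI[of _ "(a, a') # p @ [(b', b)]"]) (auto intro: le_SucI)
qed

lemma parent_unique:
  assumes "child T p v" "child T q v"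
  shows "p = q"
proof (rule ccontr)
  assume "p \<noteq> q"
  have E: "(v, p) \<in> E" "(q, v) \<in> E" and d: "depth p < depth v" "depth q = depth p"
    using assms E_sym by (auto simp: child_iff)
  have "p \<in> V T" "q \<in> V T" using assms child_in_V by auto
  from path_below_depth[OF this \<open>p \<noteq> q\<close> refl d(2)]
  obtain w where w: "awalk p w q" "distinct (pawalk_verts p w)"
    "\<And>x. x \<in> set (pawalk_verts p w) \<Longrightarrow> depth x \<le> depth p" by blast
  have cas: "pcas p w q" using w(1) by (auto simp: awalk_def)
  have "v \<notin> set (pawalk_verts p w)" using w(3) d by fastforce
  then have "distinct (tl (pawalk_verts v ((v, p) # w @ [(q, v)])))"
    using pawalk_verts_snoc[OF cas] w(2) by simp
  moreover have "awalk v ((v, p) # w @ [(q, v)]) v"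
    using w(1) E by (auto simp: awalk_Cons_iff awalk_Nil_iff dest: in_arcsD2)
  ultimately have "cycle ((v, p) # w @ [(q, v)])"
    unfolding cycle_def by (intro exI[of _ v]) simp
  \<comment> \<open>The middle walk has at least one arc, so the cycle has length at least 3; a
    back-and-forth of length 2 would contradict nothing, as \<open>is_tree\<close> permits
    it.\<close>
  moreover have "w \<noteq> []" using w(1) \<open>p \<noteq> q\<close> by (auto simp: awalk_Nil_iff)
  then have "3 \<le> length ((v, p) # w @ [(q, v)])" by (cases w) auto
  ultimately show False using no_long_cycle by fastforce
qed

section \<open>Descendant sets and ancestors\<close>

lemma V_Des: "V (Des T v) = {w. (child T)\<^sup>*\<^sup>* v w}"
  by (simp add: Des_def induced_def)

lemma V_Des_subset: "v \<in> V T \<Longrightarrow> V (Des T v) \<subseteq> V T"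
proof
  fix w assume v: "v \<in> V T" and "w \<in> V (Des T v)"
  from this(2) have "(child T)\<^sup>*\<^sup>* v w" by (simp add: V_Des)
  then show "w \<in> V T"
    by (induction rule: rtranclp_induct) (use v child_in_V in auto)
qed

text \<open>With unique parents the ancestors of a vertex form a chain. If the two sets share
  \<open>x\<close>, then \<open>v\<close> and \<open>w\<close> both lie on the chain above
  \<open>x\<close>, so one of them descends from the other.\<close>

lemma Des_laminar:
  "V (Des T v) \<inter> V (Des T w) = {} \<or> V (Des T v) \<subseteq> V (Des T w) \<or> V (Des T w) \<subseteq> V (Des T v)"
proof -
  have sv: "single_valued ({(p, c). child T p c}\<inverse>)"
    using parent_unique by (auto simp: single_valued_def)
  have "(child T)\<^sup>*\<^sup>* v w \<or> (child T)\<^sup>*\<^sup>* w v" if "(child T)\<^sup>*\<^sup>* v x" "(child T)\<^sup>*\<^sup>* w x" for x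
    using single_valued_confluent[OF sv, of x v w] that
    by (auto simp: rtranclp_rtrancl_eq rtrancl_converse)
  then show ?thesis by (auto simp: V_Des intro: rtranclp_trans)
qed

text \<open>Climbing \<open>n\<close> times to the parent gives a walk of length \<open>n\<close>;
  no shorter one exists, because the depth drops by exactly \<open>n\<close> and the triangle
  inequality from the root bounds this drop by the distance.\<close>

lemma ancestor_exists:
  assumes "v \<in> V T" "n \<le> depth v"
  shows "\<exists>w\<in>V T. v \<in> V (Des T w) \<and> rdist T v w = n \<and> depth v = depth w + n"
  using assms(2)
proof (induction n)
  case 0
  then show ?case using assms by (intro bexI[of _ v]) (auto simp: V_Des)
next
  case (Suc n)
  then obtain w where w: "w \<in> V T" "v \<in> V (Des T w)" "rdist T v w = n" "depth v = depth w + n"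
    by auto
  then obtain p where p: "child T p w"
    using parent_exists[of w "depth w - 1"] Suc.prems by auto
  then have pV: "p \<in> V T" and dp: "depth w = depth p + 1" using child_in_V child_iff by auto
  have "rdist T v p \<le> Suc n"
    using rdist_triangle[OF assms(1) w(1) pV] w(3) p rdist_le[of w p 1] E_sym child_iff by simp
  moreover have "depth v \<le> depth p + rdist T v p"
    using rdist_triangle[OF root_in_V pV assms(1)] rdist_commute by metis
  ultimately show ?case
    using w pV dp p by (intro bexI[of _ p]) (auto simp: V_Des intro: converse_rtranclp_into_rtranclp)
qed

section \<open>Pairings made of slots\<close>

text \<open>Three successive losses account for the final bound: the vertices of depth at most
  \<open>D\<close> number at most \<open>(\<Delta> + 1) ^ D\<close>, separation costs the factor
  \<open>(\<Delta> + 1) ^ r\<close>, and sparseness costs \<open>2 * B + 1\<close>.\<close>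

lemma slots_exist:
  fixes B \<theta> :: real
  assumes deg: "\<forall>v\<in>V T. deg T v \<le> \<Delta>" and B: "0 < B" "B \<le> \<theta>"
    and A_def: "A = {v \<in> V T. \<theta> \<le> card (V (Des T v))}"
  shows "\<exists>Y f. Y \<subseteq> A - {rroot T} \<and> f ` Y \<subseteq> A - {rroot T} \<and>
    (\<forall>u\<in>Y. rdist T u (f u) = D \<and> u \<in> V (Des T (f u))) \<and>
    (\<forall>u\<in>Y. \<forall>v\<in>Y. u \<noteq> v \<longrightarrow> r \<le> rdist T u v) \<and>
    (\<forall>w\<in>A. B * card (Y \<inter> V (Des T w)) \<le> card (V (Des T w))) \<and>
    real (card A) \<le> (real \<Delta> + 1) ^ D + (real \<Delta> + 1) ^ r * (2 * B + 1) * card Y"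
proof -
  \<comment> \<open>The inequality is strict so that the ancestor \<open>D\<close> levels up still
    has positive depth and is not the root.\<close>
  define X where "X = {v \<in> A. D < depth v}"
  have AV: "A \<subseteq> V T" and XA: "X \<subseteq> A" by (auto simp: A_def X_def)
  have finA: "finite A" and finX: "finite X"
    using finite_subset[OF AV] finite_subset[OF XA] by auto
  have cardX: "card {y \<in> X. rdist T x y \<le> r} \<le> (\<Delta> + 1) ^ r" if x: "x \<in> X" for x
  proof -
    have "card {y \<in> X. rdist T x y \<le> r} \<le> card {y \<in> V T. rdist T x y \<le> r}"
      using AV XA by (intro card_mono) auto
    also have "\<dots> \<le> (\<Delta> + 1) ^ r" using x AV XA by (intro card_ball deg) auto
    finally show ?thesis .
  qed
  have "\<exists>Z\<subseteq>X. (\<forall>u\<in>Z. \<forall>v\<in>Z. u \<noteq> v \<longrightarrow> \<not> rdist T u v \<le> r) \<and> card X \<le> (\<Delta> + 1) ^ r * card Z"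
    by (rule separated_subset[OF finX _ _ cardX]) (auto simp: rdist_commute)
  then obtain Z where Z: "Z \<subseteq> X" "\<And>u v. u \<in> Z \<Longrightarrow> v \<in> Z \<Longrightarrow> u \<noteq> v \<Longrightarrow> \<not> rdist T u v \<le> r"
    "card X \<le> (\<Delta> + 1) ^ r * card Z" by blast
  have "\<exists>Y\<subseteq>Z. (\<forall>F\<in>(\<lambda>w. V (Des T w)) ` A. B * card (Y \<inter> F) \<le> card F) \<and>
      real (card Z) \<le> (2 * B + 1) * card Y"
  proof (rule laminar_selection)
    show "finite Z" using Z(1) finX by (rule finite_subset)
    show "finite ((\<lambda>w. V (Des T w)) ` A)" using finA by simp
    fix F assume F: "F \<in> (\<lambda>w. V (Des T w)) ` A"
    then show "finite F" using AV V_Des_subset by (auto intro: finite_subset[OF _ finite_V])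
    show "B \<le> card F" using F B by (auto simp: A_def)
    show "F \<inter> G = {} \<or> F \<subseteq> G \<or> G \<subseteq> F" if "G \<in> (\<lambda>w. V (Des T w)) ` A" for G
      using F that Des_laminar by blast
  qed (use B in auto)
  then obtain Y where Y: "Y \<subseteq> Z" "\<And>w. w \<in> A \<Longrightarrow> B * card (Y \<inter> V (Des T w)) \<le> card (V (Des T w))"
    "real (card Z) \<le> (2 * B + 1) * card Y" by blast
  have "\<exists>w. w \<in> V T \<and> u \<in> V (Des T w) \<and> rdist T u w = D \<and> depth u = depth w + D" if "u \<in> Y" for u
  proof -
    have "u \<in> V T" "D \<le> depth u" using that Y(1) Z(1) AV by (auto simp: X_def)
    then show ?thesis using ancestor_exists[of u D] by auto
  qed
  then obtain f where f: "\<And>u. u \<in> Y \<Longrightarrow> f u \<in> V T \<and> u \<in> V (Des T (f u)) \<and>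
      rdist T u (f u) = D \<and> depth u = depth (f u) + D"
    by metis
  have fA: "f u \<in> A \<and> f u \<noteq> rroot T \<and> u \<noteq> rroot T" if u: "u \<in> Y" for u
  proof -
    have uX: "u \<in> X" using u Y(1) Z(1) by auto
    \<comment> \<open>The size of a descendant tree cannot decrease towards the root, so membership
      in \<open>A\<close> passes from \<open>u\<close> to its ancestor \<open>f u\<close>.\<close>
    have "V (Des T u) \<subseteq> V (Des T (f u))"
      using f[OF u] by (auto simp: V_Des intro: rtranclp_trans)
    then have "card (V (Des T u)) \<le> card (V (Des T (f u)))"
      using f[OF u] V_Des_subset finite_V by (meson card_mono finite_subset)
    then have "f u \<in> A" using uX f[OF u] by (auto simp: X_def A_def)
    moreover have "0 < depth (f u)" "0 < depth u" using f[OF u] uX by (auto simp: X_def)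
    ultimately show ?thesis by auto
  qed
  have "A \<subseteq> {v \<in> V T. depth v \<le> D} \<union> X" using AV by (auto simp: X_def)
  then have "card A \<le> card ({v \<in> V T. depth v \<le> D} \<union> X)"
    using finX by (intro card_mono) auto
  also have "\<dots> \<le> card {v \<in> V T. depth v \<le> D} + card X" by (rule card_Un_le)
  also have "\<dots> \<le> (\<Delta> + 1) ^ D + (\<Delta> + 1) ^ r * card Z"
    using Z(3) by (intro add_mono card_ball deg root_in_V)
  finally have "real (card A) \<le> real ((\<Delta> + 1) ^ D + (\<Delta> + 1) ^ r * card Z)"
    by (rule of_nat_mono)
  also have "\<dots> = (real \<Delta> + 1) ^ D + (real \<Delta> + 1) ^ r * card Z"
    by (simp add: add.commute)
  also have "\<dots> \<le> (real \<Delta> + 1) ^ D + (real \<Delta> + 1) ^ r * ((2 * B + 1) * card Y)"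
    using Y(3) by (intro add_left_mono mult_left_mono) auto
  finally have "real (card A) \<le> (real \<Delta> + 1) ^ D + (real \<Delta> + 1) ^ r * (2 * B + 1) * card Y"
    by (simp add: mult.assoc)
  moreover have "r \<le> rdist T u v" if "u \<in> Y" "v \<in> Y" "u \<noteq> v" for u v
    using Z(2)[of u v] Y(1) that by (meson nat_le_linear subsetD)
  moreover have "Y \<subseteq> A - {rroot T}" "f ` Y \<subseteq> A - {rroot T}"
    using Y(1) Z(1) XA fA by auto
  ultimately show ?thesis
    using Y(2) f by (intro exI[of _ Y] exI[of _ f]) auto
qed

text \<open>The detour from \<open>u\<close> through \<open>x\<close> and \<open>y\<close> to
  \<open>v\<close> costs at most \<open>D\<close> at either end. Hence separating the first ends of
  slots by \<open>R + 2 * D\<close> keeps all ends of different slots \<open>R\<close>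
  apart.\<close>

lemma slot_distance:
  assumes "u \<in> V T" "v \<in> V T" "f u \<in> V T" "f v \<in> V T"
    and "rdist T u (f u) = D" "rdist T v (f v) = D" "x \<in> {u, f u}" "y \<in> {v, f v}"
  shows "rdist T u v \<le> rdist T x y + 2 * D"
proof -
  have x: "x \<in> V T" "rdist T u x \<le> D" and y: "y \<in> V T" "rdist T y v \<le> D"
    using assms rdist_commute[of y v] by auto
  have "rdist T u v \<le> rdist T u x + rdist T x v" "rdist T x v \<le> rdist T x y + rdist T y v"
    using assms(1,2) x(1) y(1) by (auto intro: rdist_triangle)
  then show ?thesis using x y by linarith
qed

text \<open>The slots are arranged in \<open>m\<close> groups of \<open>s\<^sup>2\<close>, and a
  codeword selects one slot from each group. Codewords that differ in half of the positions give
  pairings that differ in half of their slots.\<close>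

lemma pairing_family:
  fixes I :: "nat set"
  assumes YA: "Y \<subseteq> A" "f ` Y \<subseteq> A" "A \<subseteq> V T"
    and slot: "\<And>u. u \<in> Y \<Longrightarrow> rdist T u (f u) = D" and D: "0 < D" and R: "0 < R"
    and sep: "\<And>u v. u \<in> Y \<Longrightarrow> v \<in> Y \<Longrightarrow> u \<noteq> v \<Longrightarrow> R + 2 * D \<le> rdist T u v"
    and m: "\<iota> * real (card (V T)) = real m"
    and size: "0 < s" "m * s\<^sup>2 \<le> card Y"
    and I: "finite I" "card I * 2 ^ m \<le> s ^ m"
  shows "\<exists>W. (\<forall>i\<in>I. pairing \<iota> T (W i)) \<and> (\<forall>i\<in>I. \<exists>U\<subseteq>Y. W i = (\<lambda>u. (u, f u)) ` U) \<and>
    (\<forall>i\<in>I. \<forall>j\<in>I. i \<noteq> j \<longrightarrow> m \<le> 2 * card (Vert (W i) - Vert (W j))) \<and>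
    (\<forall>i\<in>I. \<forall>u\<in>Vert (W i). \<forall>v\<in>Vert (W i). u \<noteq> v \<and> (u, v) \<notin> W i \<and> (v, u) \<notin> W i \<longrightarrow> R \<le> rdist T u v) \<and>
    (\<forall>i\<in>I. \<forall>j\<in>I. \<forall>u\<in>Vert (W i). \<forall>v\<in>Vert (W j). u \<noteq> v \<longrightarrow> min R D \<le> rdist T u v)"
proof -
  have YV: "u \<in> V T" "f u \<in> V T" if "u \<in> Y" for u using that YA by auto
  have dist: "R \<le> rdist T x y" if "u \<in> Y" "v \<in> Y" "u \<noteq> v" "x \<in> {u, f u}" "y \<in> {v, f v}" for u v x y
    using slot_distance[of u v f D x y] that sep[of u v] slot YV by auto
  \<comment> \<open>No partner is also a first end: within one slot the distance is
    \<open>D > 0\<close>, between two slots at least \<open>R > 0\<close>.\<close>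
  have ne: "f u \<noteq> v" if "u \<in> Y" "v \<in> Y" for u v
  proof
    assume "f u = v"
    then show False
      using dist[OF that, of "f u" v] slot[OF that(1)] D R by (cases "u = v") auto
  qed
  have inj_f: "inj_on f Y"
  proof (rule inj_onI)
    fix u v assume uv: "u \<in> Y" "v \<in> Y" "f u = f v"
    then show "u = v" using dist[of u v "f u" "f v"] R by (cases "u = v") auto
  qed
  have finY: "finite Y" using YV(1) by (intro finite_subset[OF subsetI finite_V])
  \<comment> \<open>\<open>g\<close> labels slots by a group and a letter; the group is part of the
    label, so slots chosen at different positions never coincide.\<close>
  have "\<exists>g. g ` ({..<m} \<times> {..<s\<^sup>2}) \<subseteq> Y \<and> inj_on g ({..<m} \<times> {..<s\<^sup>2})"
    using size finY by (intro card_le_inj) (auto simp: card_cartesian_product)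
  then obtain g where g: "g ` ({..<m} \<times> {..<s\<^sup>2}) \<subseteq> Y" "inj_on g ({..<m} \<times> {..<s\<^sup>2})"
    by (elim exE conjE)
  obtain \<C> where C: "\<C> \<subseteq> PiE {..<m} (\<lambda>_. {..<s\<^sup>2})"
    "\<forall>c\<in>\<C>. \<forall>d\<in>\<C>. c \<noteq> d \<longrightarrow> m \<le> 2 * card {k\<in>{..<m}. c k \<noteq> d k}"
    "s ^ m \<le> 2 ^ m * card \<C>"
    using half_distance_code[OF size(1), of m] by (elim exE conjE)
  have "finite \<C>" using C(1) by (rule finite_subset) (simp add: finite_PiE)
  moreover have "card I \<le> card \<C>"
  proof -
    have "card I * 2 ^ m \<le> card \<C> * 2 ^ m" using I(2) C(3) by (metis le_trans mult.commute)
    then show ?thesis by (rule mult_right_le_imp_le) simp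
  qed
  ultimately obtain c where c: "c ` I \<subseteq> \<C>" "inj_on c I"
    using card_le_inj[OF I(1)] by metis
  have dom: "(k, c i k) \<in> {..<m} \<times> {..<s\<^sup>2}" if "i \<in> I" "k < m" for i k
  proof -
    have "c i \<in> PiE {..<m} (\<lambda>_. {..<s\<^sup>2})" using c(1) C(1) that by auto
    then show ?thesis using that(2) PiE_mem by fastforce
  qed
  define us where "us i = map (\<lambda>k. g (k, c i k)) [0..<m]" for i
  define W where "W i = (\<lambda>u. (u, f u)) ` set (us i)" for i
  have usY: "set (us i) \<subseteq> Y" if "i \<in> I" for i
    using dom[OF that] g(1) by (auto simp: us_def)
  have VertW: "Vert (W i) = set (us i) \<union> f ` set (us i)" for i
    by (auto simp: Vert_def W_def image_image)
  have g_eqD: "k = l \<and> c i k = c j l" if "g (k, c i k) = g (l, c j l)" "i \<in> I" "j \<in> I" "k < m" "l < m"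
    for i j k l
    using inj_onD[OF g(2) that(1) dom[OF that(2,4)] dom[OF that(3,5)]] by auto
  have pairing: "pairing \<iota> T (W i)" if i: "i \<in> I" for i
    unfolding pairing_def
  proof (intro exI conjI)
    show "W i = set (zip (us i) (map f (us i)))"
      by (simp add: W_def zip_map2 zip_same_conv_map)
    show "real (length (us i)) = \<iota> * real (card (V T))" using m by (simp add: us_def)
    show "length (map f (us i)) = length (us i)" by simp
    have "distinct (us i)"
      unfolding us_def distinct_map using g_eqD[OF _ i i] by (auto intro!: inj_onI)
    then show "distinct (us i @ map f (us i))"
      using usY[OF i] inj_f ne by (auto simp: distinct_map intro: inj_on_subset)
    show "set (us i @ map f (us i)) \<subseteq> V T" using usY[OF i] YV by auto
  qed
  \<comment> \<open>It suffices to count first ends at positions where the codewords differ: they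
    are not first ends of \<open>W j\<close> by injectivity of \<open>g\<close>, and not partners in
    \<open>W j\<close> by \<open>ne\<close>.\<close>
  have diff: "m \<le> 2 * card (Vert (W i) - Vert (W j))" if ij: "i \<in> I" "j \<in> I" "i \<noteq> j" for i j
  proof -
    let ?H = "{k\<in>{..<m}. c i k \<noteq> c j k}"
    have "inj_on (\<lambda>k. g (k, c i k)) ?H"
      using g_eqD[OF _ ij(1) ij(1)] by (auto intro!: inj_onI)
    then have "card ?H = card ((\<lambda>k. g (k, c i k)) ` ?H)" by (simp add: card_image)
    also have "\<dots> \<le> card (Vert (W i) - Vert (W j))"
    proof (intro card_mono image_subsetI)
      show "finite (Vert (W i) - Vert (W j))" by (simp add: VertW)
      fix k assume k: "k \<in> ?H"
      have "g (k, c i k) \<notin> set (us j)"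
      proof
        assume "g (k, c i k) \<in> set (us j)"
        then obtain l where l: "l < m" "g (k, c i k) = g (l, c j l)" by (auto simp: us_def)
        then have "k = l \<and> c i k = c j l" using k by (intro g_eqD[OF l(2) ij(1,2)]) auto
        then show False using k by auto
      qed
      moreover have mem: "g (k, c i k) \<in> set (us i)" using k by (auto simp: us_def)
      moreover have "g (k, c i k) \<notin> f ` set (us j)"
      proof
        assume "g (k, c i k) \<in> f ` set (us j)"
        then obtain v where v: "v \<in> Y" "f v = g (k, c i k)" using usY[OF ij(2)] by auto
        moreover have "g (k, c i k) \<in> Y" using mem usY[OF ij(1)] by auto
        ultimately show False using ne by simp
      qed
      ultimately show "g (k, c i k) \<in> Vert (W i) - Vert (W j)" by (simp add: VertW)
    qed
    finally have "card ?H \<le> card (Vert (W i) - Vert (W j))" .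
    moreover have "c i \<noteq> c j" using c(2) ij by (meson inj_onD)
    then have "m \<le> 2 * card ?H" using C(2) c(1) ij by blast
    ultimately show ?thesis by linarith
  qed
  have VertE: "\<exists>u\<in>set (us i). x \<in> {u, f u}" if "x \<in> Vert (W i)" for x i
    using that by (auto simp: VertW)
  have within: "R \<le> rdist T x y"
    if xy: "i \<in> I" "x \<in> Vert (W i)" "y \<in> Vert (W i)" "x \<noteq> y" "(x, y) \<notin> W i" "(y, x) \<notin> W i" for i x y
  proof -
    obtain u v where uv: "u \<in> set (us i)" "x \<in> {u, f u}" "v \<in> set (us i)" "y \<in> {v, f v}"
      using VertE[OF xy(2)] VertE[OF xy(3)] by (elim bexE)
    \<comment> \<open>In a common slot, \<open>x\<close> and \<open>y\<close> would be equal or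
      would form a pair of \<open>W i\<close> in one of the two orders.\<close>
    have "u \<noteq> v" using uv xy by (auto simp: W_def)
    then show ?thesis using dist[of u v x y] uv usY[OF xy(1)] by blast
  qed
  have between: "min R D \<le> rdist T x y"
    if xy: "i \<in> I" "j \<in> I" "x \<in> Vert (W i)" "y \<in> Vert (W j)" "x \<noteq> y" for i j x y
  proof -
    obtain u v where uv: "u \<in> set (us i)" "x \<in> {u, f u}" "v \<in> set (us j)" "y \<in> {v, f v}"
      using VertE[OF xy(3)] VertE[OF xy(4)] by (elim bexE)
    then have Y: "u \<in> Y" "v \<in> Y" using usY xy by auto
    show ?thesis
    \<comment> \<open>Two pairings may share a slot; its two ends are only \<open>D\<close> apart,
      whence the minimum with \<open>D\<close>.\<close>
    proof (cases "u = v")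
      case True
      then show ?thesis using uv xy(5) slot[OF Y(1)] rdist_commute[of u "f u"] by auto
    next
      case False
      show ?thesis by (intro min.coboundedI1 dist[OF Y False uv(2,4)])
    qed
  qed
  have "\<exists>U\<subseteq>Y. W i = (\<lambda>u. (u, f u)) ` U" if "i \<in> I" for i
    using usY[OF that] by (auto simp: W_def)
  then show ?thesis
    using pairing diff within between by (intro exI[of _ W] conjI ballI impI) auto
qed

end

section \<open>Choice of parameters and assembly of the pairings\<close>

theorem theorem2p8:
  fixes \<epsilon> \<iota> :: real and M :: nat
  assumes eps: "0 < \<epsilon>" "\<epsilon> < 1"
    and M_ge: "M \<ge> 100"
    and M_trees: "\<And>k. k \<ge> M \<Longrightarrow>
      otter powi (- int k) / (100 * real k powr 2.5) \<le> real (card (unlabeled_trees k)) \<and>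
      real (card (unlabeled_trees k)) \<le> otter powi (- int k) / real k powr 2.5"
    and M_rtrees: "\<And>k. k \<ge> M \<Longrightarrow>
      otter powi (- int k) / (200 * real k powr 1.5) \<le> real (card (unlabeled_rtrees k)) \<and>
      real (card (unlabeled_rtrees k)) \<le> otter powi (- int k) / real k powr 1.5"
    and iota: "0 < \<iota>" "\<iota> < 1"
    and iota_logs: "ln (ln (1 / \<iota>)) > 0" "ln (ln (ln (1 / \<iota>))) > 0"
    and iota_small: "ln (ln (ln (ln (1 / \<iota>)))) > Max {real M, 1 / \<epsilon>, 1 / ln (1 / \<epsilon>)}"
  shows "\<exists>N0. \<forall>N::nat. N \<ge> N0 \<and> N > 0 \<and> (real N - 1) / 2 \<in> \<nat> \<and> \<iota> * real N \<in> \<nat> \<longrightarrow>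
    (\<forall>T \<in> tilde_T \<iota> N. \<exists>W :: nat \<Rightarrow> (nat \<times> nat) set.
      (let L = ln (ln (1 / \<iota>));
           I = {i::nat. 1 \<le> i \<and> real i \<le> exp (\<iota> * L ^ 4 * real N)} in
       (\<forall>i\<in>I. pairing \<iota> T (W i)) \<and>
       (\<forall>i\<in>I. Vert (W i) \<subseteq> pverts (T_iota \<iota> T) - {rroot T}) \<and>
       (\<forall>i\<in>I. \<forall>T' \<in> descendant_trees T. real (card (V T')) \<ge> (ln (1 / \<iota>))\<^sup>2 \<longrightarrow>
          real (card (Vert (W i) \<inter> V T')) \<le> inverse (ln (1 / \<iota>)) * real (card (V T'))) \<and>
       (\<forall>i\<in>I. \<forall>j\<in>I. i \<noteq> j \<longrightarrow>
          real (card ((Vert (W i) - Vert (W j)) \<union> (Vert (W j) - Vert (W i)))) \<ge> \<iota> * real N / 2) \<and>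
       (\<forall>i\<in>I. \<forall>(u, v) \<in> W i.
          ereal (L ^ 10) \<le> Dist T u v \<and> Dist T u v \<le> ereal (2 * L ^ 10)) \<and>
       (\<forall>i\<in>I. \<forall>u \<in> Vert (W i). \<forall>v \<in> Vert (W i).
          u \<noteq> v \<and> (u, v) \<notin> W i \<and> (v, u) \<notin> W i \<longrightarrow> ereal (10 * L ^ 10) \<le> Dist T u v) \<and>
       (\<forall>i\<in>I. \<forall>j\<in>I. i < j \<longrightarrow> (\<forall>u \<in> Vert (W i). \<forall>v \<in> Vert (W j).
          u \<noteq> v \<longrightarrow> ereal (L ^ 10) \<le> Dist T u v))))"
proof -
  define K where "K = ln (1 / \<iota>)"
  define L where "L = ln K"
  have lnL: "0 < ln L" and L0: "0 < L" using iota_logs by (simp_all add: K_def L_def)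
  have "100 < ln (ln L)"
    using iota_small M_ge by (simp add: K_def L_def)
  then have L: "2 ^ 100 \<le> L" using lnL L0 by (rule iterated_log_large)
  then have L1: "1 \<le> L" by simp
  have "0 < K" using iota by (simp add: K_def)
  then have K: "K = exp L" by (simp add: L_def)
  have K2: "2 \<le> K" using exp_ge_add_one_self[of L] L1 unfolding K by linarith
  have expK: "exp K = 1 / \<iota>" using iota by (simp add: K_def)
  have L10: "1 \<le> L ^ 10" using L by (intro one_le_power) simp
  \<comment> \<open>Rounding up keeps the lower bounds on distances; the excess of less than 1 in
    \<open>D\<close> stays below \<open>2 * L ^ 10\<close> because
    \<open>L ^ 10 \<ge> 1\<close>.\<close>
  define D where "D = nat \<lceil>L ^ 10\<rceil>"
  define R where "R = nat \<lceil>10 * L ^ 10\<rceil>"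
  have D: "L ^ 10 \<le> real D" "real D \<le> L ^ 10 + 1" and R: "10 * L ^ 10 \<le> real R" "real R \<le> 10 * L ^ 10 + 1"
    using L10 unfolding D_def R_def by linarith+
  have D0: "0 < D" and R0: "0 < R" using D(1) R(1) L10 by (auto intro: gr0I)
  define \<Delta> where "\<Delta> = nat \<lfloor>K\<^sup>2\<rfloor>"
  have \<Delta>: "real \<Delta> \<le> K\<^sup>2" using K2 by (simp add: \<Delta>_def)
  \<comment> \<open>The 2 compensates the factor \<open>2 ^ m\<close> lost in the code, and
    \<open>exp (L ^ 4) ^ m\<close> is the number of pairings wanted, as
    \<open>m = \<iota> * N\<close>.\<close>
  define s where "s = nat \<lceil>2 * exp (L ^ 4)\<rceil>"
  have s: "2 * exp (L ^ 4) \<le> real s" "real s \<le> 3 * exp (L ^ 4)"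
  proof -
    have "1 \<le> exp (L ^ 4)" using L by simp
    then show "2 * exp (L ^ 4) \<le> real s" "real s \<le> 3 * exp (L ^ 4)"
      unfolding s_def by linarith+
  qed
  have s0: "0 < s"
  proof (rule gr0I)
    assume "s = 0"
    then show False using s(1) by (simp add: not_le)
  qed
  \<comment> \<open>\<open>P\<close> bounds the loss from separation and sparseness;
    \<open>4 * K + 1\<close> is \<open>2 * B + 1\<close> for \<open>B = 2 * K\<close>.\<close>
  define P where "P = (K\<^sup>2 + 1) ^ (R + 2 * D) * (4 * K + 1)"
  have P0: "0 < P" using K2 by (simp add: P_def add_nonneg_pos)
  \<comment> \<open>The 18 is \<open>2 * 9\<close>: a 2 for discarding shallow vertices, and
    \<open>9 * exp (2 * L ^ 4)\<close> as the bound on the square of \<open>s\<close>.\<close>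
  have bound: "18 * exp (2 * L ^ 4) * K ^ 4 * P * \<iota> \<le> 1"
  proof -
    have "real (R + 2 * D) \<le> 12 * L ^ 10 + 3" using D R by simp
    from code_size_bound[OF L K this]
    have "18 * exp (2 * L ^ 4) * K ^ 4 * P \<le> 1 / \<iota>"
      unfolding P_def expK[symmetric] by (simp add: mult_ac)
    then show ?thesis using iota by (simp add: field_simps)
  qed
  show ?thesis
    unfolding Let_def K_def[symmetric] L_def[symmetric]
  \<comment> \<open>From this threshold on, the at most \<open>(K\<^sup>2 + 1) ^ D\<close> shallow
    vertices are at most half of \<open>N / K ^ 4\<close>.\<close>
  proof (intro exI[of _ "nat \<lceil>2 * K ^ 4 * (K\<^sup>2 + 1) ^ D\<rceil>"] allI impI ballI)
    fix N :: nat and T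
    assume N: "nat \<lceil>2 * K ^ 4 * (K\<^sup>2 + 1) ^ D\<rceil> \<le> N \<and> 0 < N \<and> (real N - 1) / 2 \<in> \<nat> \<and> \<iota> * real N \<in> \<nat>"
      and T: "T \<in> tilde_T \<iota> N"
    obtain m where m: "\<iota> * real N = real m" using N by (auto elim: Nats_cases)
    have "is_rtree T" and cardV: "card (V T) = N" using T by (auto simp: tilde_T_def rtrees_def)
    then interpret rooted_tree T by unfold_locales
    define A where "A = {v \<in> V T. K\<^sup>2 \<le> card (V (Des T v))}"
    have A: "pverts (T_iota \<iota> T) = A" by (simp add: T_iota_def induced_def A_def K_def)
    have cardA: "real N / K ^ 4 \<le> real (card A)"
      using T unfolding A[symmetric] by (simp add: tilde_T_def K_def)
    have deg: "\<forall>v\<in>V T. deg T v \<le> \<Delta>"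
    proof
      fix v assume "v \<in> V T"
      then have "real (deg T v) \<le> K\<^sup>2" using T unfolding tilde_T_def K_def by blast
      then show "deg T v \<le> \<Delta>" unfolding \<Delta>_def by linarith
    qed
    \<comment> \<open>The first ends get density \<open>1 / (2 * K)\<close>, so that together with
      their partners they have density at most \<open>1 / K\<close>.\<close>
    have "0 < 2 * K" "2 * K \<le> K\<^sup>2" using K2 by (auto simp: power2_eq_square)
    from slots_exist[OF deg this A_def, of D "R + 2 * D"]
    obtain Y f where YA: "Y \<subseteq> A - {rroot T}" "f ` Y \<subseteq> A - {rroot T}"
      and slot: "\<forall>u\<in>Y. rdist T u (f u) = D \<and> u \<in> V (Des T (f u))"
      and sep: "\<forall>u\<in>Y. \<forall>v\<in>Y. u \<noteq> v \<longrightarrow> R + 2 * D \<le> rdist T u v"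
      and sparse: "\<forall>w\<in>A. 2 * K * card (Y \<inter> V (Des T w)) \<le> card (V (Des T w))"
      and cardY: "real (card A) \<le> (real \<Delta> + 1) ^ D +
        (real \<Delta> + 1) ^ (R + 2 * D) * (2 * (2 * K) + 1) * card Y"
      by (elim exE conjE)
    have "real (m * s\<^sup>2) \<le> real (card Y)"
    proof -
      have "(real \<Delta> + 1) ^ D \<le> (K\<^sup>2 + 1) ^ D" using \<Delta> by (intro power_mono) auto
      also have "\<dots> \<le> real N / (2 * K ^ 4)"
      proof -
        have "2 * K ^ 4 * (K\<^sup>2 + 1) ^ D \<le> real N" using N by linarith
        then show ?thesis using K2 by (simp add: field_simps)
      qed
      finally have small: "(real \<Delta> + 1) ^ D \<le> real N / (2 * K ^ 4)" .
      have "(real \<Delta> + 1) ^ (R + 2 * D) * (2 * (2 * K) + 1) * card Y \<le> P * card Y"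
        unfolding P_def using \<Delta> K2 by (intro mult_mono power_mono) auto
      then have "real N / K ^ 4 \<le> real N / (2 * K ^ 4) + P * card Y"
        using cardA cardY small by linarith
      then have N_le: "real N \<le> 2 * K ^ 4 * P * card Y"
        using K2 by (simp add: field_simps)
      have "(real s)\<^sup>2 \<le> (3 * exp (L ^ 4))\<^sup>2" using s by (intro power_mono) auto
      also have "\<dots> = 9 * exp (2 * L ^ 4)" by (simp add: power_mult_distrib exp_double)
      finally have s2: "(real s)\<^sup>2 \<le> 9 * exp (2 * L ^ 4)" .
      have "real (m * s\<^sup>2) = \<iota> * real N * (real s)\<^sup>2" using m by simp
      also have "\<dots> \<le> \<iota> * (2 * K ^ 4 * P * card Y) * (9 * exp (2 * L ^ 4))"
        using iota N_le s2 K2 P0 by (intro mult_mono mult_left_mono) auto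
      also have "\<dots> = 18 * exp (2 * L ^ 4) * K ^ 4 * P * \<iota> * card Y" by simp
      also have "\<dots> \<le> 1 * real (card Y)" using bound by (intro mult_right_mono) auto
      finally show ?thesis by simp
    qed
    then have size: "m * s\<^sup>2 \<le> card Y" by linarith
    define I where "I = {i::nat. 1 \<le> i \<and> real i \<le> exp (\<iota> * L ^ 4 * real N)}"
    have I_sub: "I \<subseteq> {1..nat \<lfloor>exp (\<iota> * L ^ 4 * real N)\<rfloor>}"
      by (auto simp: I_def le_nat_floor)
    then have finI: "finite I" by (rule finite_subset) simp
    have "real (card I) \<le> exp (\<iota> * L ^ 4 * real N)"
    proof -
      have "card I \<le> nat \<lfloor>exp (\<iota> * L ^ 4 * real N)\<rfloor>" using card_mono[OF _ I_sub] by simp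
      moreover have "0 \<le> exp (\<iota> * L ^ 4 * real N)" by simp
      ultimately show ?thesis by linarith
    qed
    also have "\<iota> * L ^ 4 * real N = real m * L ^ 4" using m by (simp add: mult_ac)
    also have "exp (real m * L ^ 4) = exp (L ^ 4) ^ m" by (simp add: exp_of_nat_mult)
    finally have "real (card I) * 2 ^ m \<le> (2 * exp (L ^ 4)) ^ m"
      by (simp add: power_mult_distrib mult.commute)
    also have "\<dots> \<le> real s ^ m" using s by (intro power_mono) auto
    finally have "real (card I * 2 ^ m) \<le> real (s ^ m)" by simp
    then have cardI: "card I * 2 ^ m \<le> s ^ m" by (simp only: of_nat_le_iff)
    have "\<exists>W. (\<forall>i\<in>I. pairing \<iota> T (W i)) \<and> (\<forall>i\<in>I. \<exists>U\<subseteq>Y. W i = (\<lambda>u. (u, f u)) ` U) \<and>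
      (\<forall>i\<in>I. \<forall>j\<in>I. i \<noteq> j \<longrightarrow> m \<le> 2 * card (Vert (W i) - Vert (W j))) \<and>
      (\<forall>i\<in>I. \<forall>u\<in>Vert (W i). \<forall>v\<in>Vert (W i).
        u \<noteq> v \<and> (u, v) \<notin> W i \<and> (v, u) \<notin> W i \<longrightarrow> R \<le> rdist T u v) \<and>
      (\<forall>i\<in>I. \<forall>j\<in>I. \<forall>u\<in>Vert (W i). \<forall>v\<in>Vert (W j). u \<noteq> v \<longrightarrow> min R D \<le> rdist T u v)"
      by (rule pairing_family[of Y A f D R \<iota> m s I])
        (use YA slot sep D0 R0 m cardV size s0 finI cardI in \<open>auto simp: A_def\<close>)
    then obtain W where W: "\<forall>i\<in>I. pairing \<iota> T (W i)"
      and WU: "\<forall>i\<in>I. \<exists>U\<subseteq>Y. W i = (\<lambda>u. (u, f u)) ` U"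
      and diff: "\<forall>i\<in>I. \<forall>j\<in>I. i \<noteq> j \<longrightarrow> m \<le> 2 * card (Vert (W i) - Vert (W j))"
      and within: "\<forall>i\<in>I. \<forall>u\<in>Vert (W i). \<forall>v\<in>Vert (W i).
        u \<noteq> v \<and> (u, v) \<notin> W i \<and> (v, u) \<notin> W i \<longrightarrow> R \<le> rdist T u v"
      and between: "\<forall>i\<in>I. \<forall>j\<in>I. \<forall>u\<in>Vert (W i). \<forall>v\<in>Vert (W j).
        u \<noteq> v \<longrightarrow> min R D \<le> rdist T u v"
      by (elim exE conjE)
    note W = W[rule_format] and WU = WU[rule_format] and diff = diff[rule_format]
      and within = within[rule_format] and between = between[rule_format]
    have finV: "finite (Vert (W i))" if "i \<in> I" for i
      using W[OF that] by (auto simp: pairing_def Vert_def)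
    have VertA: "Vert (W i) \<subseteq> A - {rroot T}" if i: "i \<in> I" for i
    proof -
      obtain U where U: "U \<subseteq> Y" "W i = (\<lambda>u. (u, f u)) ` U" using WU[OF i] by blast
      have "Vert (W i) = U \<union> f ` U" by (simp add: U(2) Vert_def image_image)
      then show ?thesis using U(1) YA by blast
    qed
    have AV: "A \<subseteq> V T" by (auto simp: A_def)
    have Dist_Vert: "Dist T u v = ereal (real (rdist T u v))"
      if "i \<in> I" "j \<in> I" "u \<in> Vert (W i)" "v \<in> Vert (W j)" for i j u v
      using that VertA AV by (intro Dist_eq) blast+
    show "\<exists>W. (\<forall>i\<in>{i. 1 \<le> i \<and> real i \<le> exp (\<iota> * L ^ 4 * real N)}. pairing \<iota> T (W i)) \<and>
       (\<forall>i\<in>{i. 1 \<le> i \<and> real i \<le> exp (\<iota> * L ^ 4 * real N)}. Vert (W i) \<subseteq> pverts (T_iota \<iota> T) - {rroot T}) \<and>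
       (\<forall>i\<in>{i. 1 \<le> i \<and> real i \<le> exp (\<iota> * L ^ 4 * real N)}.
          \<forall>T' \<in> descendant_trees T. real (card (V T')) \<ge> K\<^sup>2 \<longrightarrow>
          real (card (Vert (W i) \<inter> V T')) \<le> inverse K * real (card (V T'))) \<and>
       (\<forall>i\<in>{i. 1 \<le> i \<and> real i \<le> exp (\<iota> * L ^ 4 * real N)}.
          \<forall>j\<in>{i. 1 \<le> i \<and> real i \<le> exp (\<iota> * L ^ 4 * real N)}. i \<noteq> j \<longrightarrow>
          real (card ((Vert (W i) - Vert (W j)) \<union> (Vert (W j) - Vert (W i)))) \<ge> \<iota> * real N / 2) \<and>
       (\<forall>i\<in>{i. 1 \<le> i \<and> real i \<le> exp (\<iota> * L ^ 4 * real N)}. \<forall>(u, v) \<in> W i.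
          ereal (L ^ 10) \<le> Dist T u v \<and> Dist T u v \<le> ereal (2 * L ^ 10)) \<and>
       (\<forall>i\<in>{i. 1 \<le> i \<and> real i \<le> exp (\<iota> * L ^ 4 * real N)}. \<forall>u \<in> Vert (W i). \<forall>v \<in> Vert (W i).
          u \<noteq> v \<and> (u, v) \<notin> W i \<and> (v, u) \<notin> W i \<longrightarrow> ereal (10 * L ^ 10) \<le> Dist T u v) \<and>
       (\<forall>i\<in>{i. 1 \<le> i \<and> real i \<le> exp (\<iota> * L ^ 4 * real N)}.
          \<forall>j\<in>{i. 1 \<le> i \<and> real i \<le> exp (\<iota> * L ^ 4 * real N)}. i < j \<longrightarrow>
          (\<forall>u \<in> Vert (W i). \<forall>v \<in> Vert (W j). u \<noteq> v \<longrightarrow> ereal (L ^ 10) \<le> Dist T u v))"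
      unfolding I_def[symmetric]
    proof (intro exI[of _ W] conjI ballI impI)
      fix i assume i: "i \<in> I"
      show "pairing \<iota> T (W i)" by (rule W[OF i])
      show "Vert (W i) \<subseteq> pverts (T_iota \<iota> T) - {rroot T}" unfolding A by (rule VertA[OF i])
      show "real (card (Vert (W i) \<inter> V T')) \<le> inverse K * real (card (V T'))"
        if T': "T' \<in> descendant_trees T" "K\<^sup>2 \<le> real (card (V T'))" for T'
      proof -
        obtain w where w: "w \<in> V T" "T' = Des T w" using T'(1) by (auto simp: descendant_trees_def)
        then have wA: "w \<in> A" using T'(2) by (simp add: A_def)
        have finT': "finite (V T')" unfolding w(2) by (rule finite_subset[OF V_Des_subset[OF w(1)] finite_V])
        have "Vert (W i) \<inter> V T' \<subseteq> (Y \<inter> V T') \<union> f ` (Y \<inter> V T')"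
        proof
          fix x assume x: "x \<in> Vert (W i) \<inter> V T'"
          obtain U where U: "U \<subseteq> Y" "W i = (\<lambda>u. (u, f u)) ` U" using WU[OF i] by blast
          then obtain u where u: "u \<in> Y" "x = u \<or> x = f u" using x by (auto simp: Vert_def)
          \<comment> \<open>A descendant tree containing the ancestor \<open>f u\<close> contains
            \<open>u\<close> as well, so every endpoint in \<open>T'\<close> is charged to a first
            end in \<open>T'\<close>, each of which is charged at most twice.\<close>
          have "u \<in> V T'" if "f u \<in> V T'"
            using that slot u(1) unfolding w(2) V_Des by (auto intro: rtranclp_trans)
          then show "x \<in> (Y \<inter> V T') \<union> f ` (Y \<inter> V T')" using u x by blast
        qed
        then have "card (Vert (W i) \<inter> V T') \<le> card ((Y \<inter> V T') \<union> f ` (Y \<inter> V T'))"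
          using finT' by (intro card_mono) auto
        also have "\<dots> \<le> card (Y \<inter> V T') + card (f ` (Y \<inter> V T'))" by (rule card_Un_le)
        also have "\<dots> \<le> 2 * card (Y \<inter> V T')" using card_image_le[of "Y \<inter> V T'" f] finT' by simp
        finally have "K * real (card (Vert (W i) \<inter> V T')) \<le> K * (2 * real (card (Y \<inter> V T')))"
          using K2 by (intro mult_left_mono) auto
        also have "\<dots> \<le> card (V T')" using sparse wA unfolding w(2) by auto
        finally show ?thesis using K2 by (simp add: field_simps)
      qed
      show "\<iota> * real N / 2 \<le> real (card ((Vert (W i) - Vert (W j)) \<union> (Vert (W j) - Vert (W i))))"
        if "j \<in> I" "i \<noteq> j" for j
      proof -
        \<comment> \<open>One side of the symmetric difference already has at least
          \<open>m / 2\<close> elements.\<close>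
        have "card (Vert (W i) - Vert (W j)) \<le> card ((Vert (W i) - Vert (W j)) \<union> (Vert (W j) - Vert (W i)))"
          using finV[OF i] finV[OF that(1)] by (intro card_mono) auto
        then show ?thesis using diff[OF i that] m by linarith
      qed
      show "case e of (u, v) \<Rightarrow> ereal (L ^ 10) \<le> Dist T u v \<and> Dist T u v \<le> ereal (2 * L ^ 10)"
        if e: "e \<in> W i" for e
      proof -
        obtain u where u: "u \<in> Y" "e = (u, f u)" using WU[OF i] e by blast
        then have "Dist T u (f u) = ereal (real D)" using YA AV slot by (subst Dist_eq) auto
        then show ?thesis using u D L10 by simp
      qed
      show "ereal (10 * L ^ 10) \<le> Dist T u v"
        if uv: "u \<in> Vert (W i)" "v \<in> Vert (W i)" "u \<noteq> v \<and> (u, v) \<notin> W i \<and> (v, u) \<notin> W i" for u v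
        using within[OF i uv] R by (simp add: Dist_Vert[OF i i uv(1,2)])
      show "ereal (L ^ 10) \<le> Dist T u v"
        if j: "j \<in> I" "i < j" and uv: "u \<in> Vert (W i)" "v \<in> Vert (W j)" "u \<noteq> v" for j u v
      proof -
        have "min R D \<le> rdist T u v" by (rule between[OF i j(1) uv])
        moreover have "L ^ 10 \<le> real (min R D)" using R D L10 by (auto simp: min_def)
        ultimately have "L ^ 10 \<le> real (rdist T u v)" by linarith
        then show ?thesis by (simp add: Dist_Vert[OF i j(1) uv(1,2)])
      qed
    qed
  qed
qed

end
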